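(* Let $P$ be a finite ergodic Markov kernel on $V$ with stationary distribution $\pi$. Let $x,y\in V$, $S_0=\{x\}$, and $n\ge 0$. Then \begin{align*} s(P^n(x,\cdot),\pi) &\le \mathrm{Prob}_{\hat K^n}(S_n\ne V),\\ \|P^n(x,\cdot)-\pi\|_{TV} &\le \hat{\mathbb E}_n(1-\pi(S_n)),\\ D(P^n(x,\cdot)\,\|\,\pi) &\le \hat{\mathbb E}_n\log\frac{1}{\pi(S_n)},\\ \left\|\frac{P^n(x,\cdot)}{\pi}-1\right\|_{2,\pi} &\le \hat{\mathbb E}_n\sqrt{\frac{1-\pi(S_n)}{\pi(S_n)}},\\ \left|\frac{P^n(x,y)}{\pi(y)}-1\right| &\le \max\left\{\frac{1-\pi(y)}{\pi(y)},1\right\}\mathrm{Prob}_{\hat K^n}(S_n\neq V),\\ H(P^n(x,\cdot),\pi) &\le 2\,\hat{\mathbb E}_n\bigl(1-\sqrt{\pi(S_n)}\bigr),\\ W_p(P^n(x,\cdot),\pi) &\le \sqrt[p]{\hat{\mathbb E}_n W_p^p(\pi_{S_n},\pi)} . \end{align*}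
   Context: $P$ is a stochastic matrix on the finite set $V$, irreducible and aperiodic, with stationary distribution $\pi$. For $A,B\subset V$, $Q(A,B)=\sum_{x\in A,y\in B}\pi(x)P(x,y)$ and $Q(A,y)=Q(A,\{y\})$. Evolving set process: from $A\subset V$ choose $u\in[0,1]$ uniformly at random and move to $A_u=\{y\in V: Q(A,y)\ge u\,\pi(y)\}$; its kernel on subsets is $K(A,S)=\mathrm{Prob}(A_u=S)$. Its Doob transform is the Markov chain on nonempty subsets with kernel $\hat K(S,S')=\frac{\pi(S')}{\pi(S)}K(S,S')$. $S_0,S_1,\dots$ denotes the chain with kernel $\hat K$, and $\hat{\mathbb E}_n$, $\mathrm{Prob}_{\hat K^n}$ are expectation and probability under $\hat K^n$ started at $S_0$. $\pi_S(y)=\mathbf 1_S(y)\pi(y)/\pi(S)$. Distances, for a probability distribution $\mu$ on $V$: $s(\mu,\pi)=\max_{x}\bigl(1-\frac{\mu(x)}{\pi(x)}\bigr)$; $\|\mu-\pi\|_{TV}=\frac12\sum_x|\mu(x)-\pi(x)|$; $D(\mu\|\pi)=\sum_x\mu(x)\log\frac{\mu(x)}{\pi(x)}$; $\|\frac{\mu}{\pi}-1\|_{2,\pi}=\sqrt{\sum_x\pi(x)|\frac{\mu(x)}{\pi(x)}-1|^2}$; $H(\mu,\pi)=\sum_y\bigl(\sqrt{\mu(y)/\pi(y)}-1\bigr)^2\pi(y)$; and, given a metric $d:V\times V\to\mathbb R^+$ and $p\ge1$, $W_p(\mu,\pi)$ is defined by $W_p^p(\mu,\pi)=\sup\{\mathbb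 E_\mu f+\mathbb E_\pi g:\ f,g:V\to\mathbb R,\ f(y)+g(z)\le d(y,z)^p\ \forall y,z\in V\}$. *)

theory Defs
  imports "HOL-Analysis.Analysis"
begin

definition prob_vec :: "('v::finite \<Rightarrow> real) \<Rightarrow> bool" where
  "prob_vec \<mu> \<longleftrightarrow> (\<forall>x. 0 \<le> \<mu> x) \<and> (\<Sum>x\<in>UNIV. \<mu> x) = 1"

definition stochastic :: "('v::finite \<Rightarrow> 'v \<Rightarrow> real) \<Rightarrow> bool" where
  "stochastic P \<longleftrightarrow> (\<forall>x. prob_vec (P x))"

text \<open>Powers of a kernel on the state space \<open>X\<close>.\<close>

fun kernel_pow :: "'s set \<Rightarrow> ('s \<Rightarrow> 's \<Rightarrow> real) \<Rightarrow> nat \<Rightarrow> 's \<Rightarrow> 's \<Rightarrow> real" where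
  "kernel_pow X K 0 x y = (if x = y then 1 else 0)"
| "kernel_pow X K (Suc n) x y = (\<Sum>z\<in>X. kernel_pow X K n x z * K z y)"

definition irreducible_kernel :: "('v::finite \<Rightarrow> 'v \<Rightarrow> real) \<Rightarrow> bool" where
  "irreducible_kernel P \<longleftrightarrow> (\<forall>x y. \<exists>n. kernel_pow UNIV P n x y > 0)"

definition aperiodic_kernel :: "('v::finite \<Rightarrow> 'v \<Rightarrow> real) \<Rightarrow> bool" where
  "aperiodic_kernel P \<longleftrightarrow> (\<forall>x. Gcd {n::nat. n > 0 \<and> kernel_pow UNIV P n x x > 0} = 1)"

definition stationary_distribution :: "('v::finite \<Rightarrow> 'v \<Rightarrow> real) \<Rightarrow> ('v \<Rightarrow> real) \<Rightarrow> bool" where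
  "stationary_distribution P \<pi> \<longleftrightarrow> prob_vec \<pi> \<and> (\<forall>y. (\<Sum>x\<in>UNIV. \<pi> x * P x y) = \<pi> y)"

definition ergodic_flow ::
  "('v::finite \<Rightarrow> 'v \<Rightarrow> real) \<Rightarrow> ('v \<Rightarrow> real) \<Rightarrow> 'v set \<Rightarrow> 'v set \<Rightarrow> real" where
  "ergodic_flow P \<pi> A B = (\<Sum>x\<in>A. \<Sum>y\<in>B. \<pi> x * P x y)"

definition evolve ::
  "('v::finite \<Rightarrow> 'v \<Rightarrow> real) \<Rightarrow> ('v \<Rightarrow> real) \<Rightarrow> 'v set \<Rightarrow> real \<Rightarrow> 'v set" where
  "evolve P \<pi> A u = {y. ergodic_flow P \<pi> A {y} \<ge> u * \<pi> y}"

definition evolving_kernel ::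
  "('v::finite \<Rightarrow> 'v \<Rightarrow> real) \<Rightarrow> ('v \<Rightarrow> real) \<Rightarrow> 'v set \<Rightarrow> 'v set \<Rightarrow> real" where
  "evolving_kernel P \<pi> A S = measure (uniform_measure lborel {0..1}) {u. evolve P \<pi> A u = S}"

definition doob_kernel ::
  "('v::finite \<Rightarrow> 'v \<Rightarrow> real) \<Rightarrow> ('v \<Rightarrow> real) \<Rightarrow> 'v set \<Rightarrow> 'v set \<Rightarrow> real" where
  "doob_kernel P \<pi> S S' = (sum \<pi> S' / sum \<pi> S) * evolving_kernel P \<pi> S S'"

text \<open>The transformed chain lives on the nonempty subsets; \<open>doob_expectation P \<pi> S0 n f\<close> and
  \<open>doob_prob P \<pi> S0 n E\<close> are the expectation of \<open>f(S\<^sub>n)\<close> and the probability of \<open>E(S\<^sub>n)\<close>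
  for the chain started at \<open>S0\<close>.\<close>

definition doob_law ::
  "('v::finite \<Rightarrow> 'v \<Rightarrow> real) \<Rightarrow> ('v \<Rightarrow> real) \<Rightarrow> 'v set \<Rightarrow> nat \<Rightarrow> 'v set \<Rightarrow> real" where
  "doob_law P \<pi> S0 n = kernel_pow {S. S \<noteq> {}} (doob_kernel P \<pi>) n S0"

definition doob_expectation ::
  "('v::finite \<Rightarrow> 'v \<Rightarrow> real) \<Rightarrow> ('v \<Rightarrow> real) \<Rightarrow> 'v set \<Rightarrow> nat \<Rightarrow> ('v set \<Rightarrow> real) \<Rightarrow> real" where
  "doob_expectation P \<pi> S0 n f = (\<Sum>S | S \<noteq> {}. doob_law P \<pi> S0 n S * f S)"

definition doob_prob ::
  "('v::finite \<Rightarrow> 'v \<Rightarrow> real) \<Rightarrow> ('v \<Rightarrow> real) \<Rightarrow> 'v set \<Rightarrow> nat \<Rightarrow> ('v set \<Rightarrow> bool) \<Rightarrow> real" where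
  "doob_prob P \<pi> S0 n E = (\<Sum>S | S \<noteq> {} \<and> E S. doob_law P \<pi> S0 n S)"

definition restrict_dist :: "('v::finite \<Rightarrow> real) \<Rightarrow> 'v set \<Rightarrow> 'v \<Rightarrow> real" where
  "restrict_dist \<pi> S y = indicator S y * \<pi> y / sum \<pi> S"

definition separation :: "('v::finite \<Rightarrow> real) \<Rightarrow> ('v \<Rightarrow> real) \<Rightarrow> real" where
  "separation \<mu> \<pi> = Max (range (\<lambda>x. 1 - \<mu> x / \<pi> x))"

definition tv_dist :: "('v::finite \<Rightarrow> real) \<Rightarrow> ('v \<Rightarrow> real) \<Rightarrow> real" where
  "tv_dist \<mu> \<pi> = 1 / 2 * (\<Sum>x\<in>UNIV. \<bar>\<mu> x - \<pi> x\<bar>)"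

text \<open>The convention \<open>0 log 0 = 0\<close> holds automatically.\<close>

definition rel_entropy :: "('v::finite \<Rightarrow> real) \<Rightarrow> ('v \<Rightarrow> real) \<Rightarrow> real" where
  "rel_entropy \<mu> \<pi> = (\<Sum>x\<in>UNIV. \<mu> x * ln (\<mu> x / \<pi> x))"

definition l2_dist :: "('v::finite \<Rightarrow> real) \<Rightarrow> ('v \<Rightarrow> real) \<Rightarrow> real" where
  "l2_dist \<mu> \<pi> = sqrt (\<Sum>x\<in>UNIV. \<pi> x * \<bar>\<mu> x / \<pi> x - 1\<bar>\<^sup>2)"

definition hellinger :: "('v::finite \<Rightarrow> real) \<Rightarrow> ('v \<Rightarrow> real) \<Rightarrow> real" where
  "hellinger \<mu> \<pi> = (\<Sum>y\<in>UNIV. (sqrt (\<mu> y / \<pi> y) - 1)\<^sup>2 * \<pi> y)"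

text \<open>For probability vectors the set below is nonempty (take \<open>f = g = 0\<close>) and bounded above
  (average the constraint over the product coupling), so the real supremum is the genuine one and
  is nonnegative; hence its \<open>p\<close>-th root may be written with \<open>powr\<close>.\<close>

definition wasserstein ::
  "('v::finite \<Rightarrow> 'v \<Rightarrow> real) \<Rightarrow> real \<Rightarrow> ('v \<Rightarrow> real) \<Rightarrow> ('v \<Rightarrow> real) \<Rightarrow> real" where
  "wasserstein d p \<mu> \<pi> =
    (SUP (f, g) \<in> {(f, g). \<forall>y z. f y + g z \<le> d y z powr p}.
       (\<Sum>y\<in>UNIV. \<mu> y * f y) + (\<Sum>z\<in>UNIV. \<pi> z * g z)) powr (1 / p)"

end

theory Submission
  imports Defs
begin

text \<open>Since \<open>\<Sum>\<^sub>S K(A,S) 1\<^sub>S(y) = Q(A,y)/\<pi>(y)\<close>, induction on \<open>n\<close> shows that \<open>P\<^sup>n(x,\<cdot>)\<close> is the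
  mixture of the distributions \<open>\<pi>\<^sub>S\<close> with weights \<open>Prob(S\<^sub>n = S)\<close>. Each distance (for \<open>W\<^sub>p\<close>, its
  \<open>p\<close>-th power) is a convex function of its first argument, so the distance of the mixture is at most the average of the distances of
  the \<open>\<pi>\<^sub>S\<close>, which are computed explicitly.\<close>

section \<open>The duality between the chain and the evolving sets\<close>

lemma kernel_pow_nonneg:
  assumes "\<And>a b. 0 \<le> K a b"
  shows "0 \<le> kernel_pow X K n x y"
  by (induction n arbitrary: y) (auto intro!: sum_nonneg mult_nonneg_nonneg assms)

lemma sum_kernel_pow_stochastic:
  assumes "stochastic P"
  shows "(\<Sum>y\<in>UNIV. kernel_pow UNIV P n x y) = 1"
proof (induction n)
  case (Suc n)
  have "(\<Sum>y\<in>UNIV. kernel_pow UNIV P (Suc n) x y)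
      = (\<Sum>z\<in>UNIV. \<Sum>y\<in>UNIV. kernel_pow UNIV P n x z * P z y)"
    unfolding kernel_pow.simps by (rule sum.swap)
  also have "\<dots> = (\<Sum>z\<in>UNIV. kernel_pow UNIV P n x z)"
    using assms by (simp add: stochastic_def prob_vec_def flip: sum_distrib_left)
  finally show ?case using Suc by simp
qed simp

lemma stationary_kernel_pow:
  assumes "stationary_distribution P \<pi>"
  shows "(\<Sum>x\<in>UNIV. \<pi> x * kernel_pow UNIV P n x y) = \<pi> y"
proof (induction n arbitrary: y)
  case 0
  show ?case by (simp add: if_distrib cong: if_cong)
next
  case (Suc n)
  have "(\<Sum>x\<in>UNIV. \<pi> x * kernel_pow UNIV P (Suc n) x y)
      = (\<Sum>x\<in>UNIV. \<Sum>z\<in>UNIV. (\<pi> x * kernel_pow UNIV P n x z) * P z y)"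
    by (simp add: sum_distrib_left mult.assoc)
  also have "\<dots> = (\<Sum>z\<in>UNIV. \<Sum>x\<in>UNIV. (\<pi> x * kernel_pow UNIV P n x z) * P z y)"
    by (rule sum.swap)
  also have "\<dots> = (\<Sum>z\<in>UNIV. \<pi> z * P z y)"
    using Suc by (simp flip: sum_distrib_right)
  finally show ?case using assms by (simp add: stationary_distribution_def)
qed

text \<open>Some state \<open>z\<close> carries mass because the total is one. Irreducibility gives
  a power of \<open>P\<close> that leads from \<open>z\<close> to \<open>y\<close>, and \<pi> is
  invariant under that power, so mass reaches \<open>y\<close>. This justifies every later division
  by \<open>\<pi> y\<close>.\<close>

lemma stationary_distribution_pos:
  assumes "stochastic P" "irreducible_kernel P" "stationary_distribution P \<pi>"
  shows "0 < \<pi> y"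
proof -
  have nn: "\<And>z. 0 \<le> \<pi> z" and one: "sum \<pi> UNIV = 1"
    using assms(3) by (auto simp: stationary_distribution_def prob_vec_def)
  obtain z where z: "0 < \<pi> z"
    using one nn by (metis less_le sum.neutral zero_neq_one)
  obtain n where n: "0 < kernel_pow UNIV P n z y"
    using assms(2) by (auto simp: irreducible_kernel_def)
  have P: "\<And>a b. 0 \<le> P a b"
    using assms(1) by (auto simp: stochastic_def prob_vec_def)
  have "0 < \<pi> z * kernel_pow UNIV P n z y" using z n by simp
  also have "\<dots> \<le> (\<Sum>x\<in>UNIV. \<pi> x * kernel_pow UNIV P n x y)"
    by (rule member_le_sum) (auto intro!: mult_nonneg_nonneg nn kernel_pow_nonneg P)
  finally show ?thesis using stationary_kernel_pow[OF assms(3)] by simp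
qed

section \<open>One step of the evolving sets and of their Doob transform\<close>

lemma evolve_vimage_sets: "{u. evolve P \<pi> A u = S} \<in> sets lborel"
proof -
  have "{u. evolve P \<pi> A u = S}
      = {u. \<forall>y. (u * \<pi> y \<le> ergodic_flow P \<pi> A {y}) = (y \<in> S)}"
    by (auto simp: evolve_def)
  also have "\<dots> \<in> sets lborel" by measurable
  finally show ?thesis .
qed

lemma measure_uniform_unit_le:
  assumes "0 < (c::real)" "0 \<le> q" "q \<le> c"
  shows "measure (uniform_measure lborel {0..1}) {u. u * c \<le> q} = q / c"
proof -
  have "{0..1} \<inter> {u. u * c \<le> q} = {0..q / c}"
  proof -
    have "u \<le> 1" if "u \<le> q / c" for u
      using that assms by (auto intro: order_trans)
    then show ?thesis using assms by (auto simp: pos_le_divide_eq)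
  qed
  moreover have "{u. u * c \<le> q} \<in> sets lborel" by measurable
  ultimately show ?thesis using assms by simp
qed

text \<open>The events \<open>evolve P \<pi> A u = S\<close> with \<open>y \<in> S\<close> are
  disjoint, and their union is the event that the threshold u is at most Q(A,y)/\<pi>(y). The
  uniform law gives this event exactly that ratio as probability once the ratio lies in the unit
  interval.\<close>

lemma sum_evolving_kernel_containing:
  assumes "stochastic P" "stationary_distribution P \<pi>" "0 < \<pi> y"
  shows "(\<Sum>S | y \<in> S. evolving_kernel P \<pi> A S) = ergodic_flow P \<pi> A {y} / \<pi> y"
proof -
  let ?M = "uniform_measure lborel {0..1::real}"
  have nn: "\<And>a. 0 \<le> \<pi> a * P a y"
    using assms by (auto simp: stochastic_def stationary_distribution_def prob_vec_def)
  \<comment> \<open>By stationarity the right-hand side is \<open>\<pi> y\<close>, so the ratio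
    Q(A,y)/\<pi>(y) is at most one.\<close>
  have le: "ergodic_flow P \<pi> A {y} \<le> (\<Sum>a\<in>UNIV. \<pi> a * P a y)"
    unfolding ergodic_flow_def using nn by (auto intro!: sum_mono2)
  interpret finite_measure ?M by (rule finite_measureI) simp
  have "(\<Sum>S | y \<in> S. evolving_kernel P \<pi> A S)
      = measure ?M (\<Union>S\<in>{S. y \<in> S}. {u. evolve P \<pi> A u = S})"
    unfolding evolving_kernel_def
    by (rule finite_measure_finite_Union[symmetric])
       (use evolve_vimage_sets in \<open>auto simp: disjoint_family_on_def\<close>)
  also have "(\<Union>S\<in>{S. y \<in> S}. {u. evolve P \<pi> A u = S}) = {u. u * \<pi> y \<le> ergodic_flow P \<pi> A {y}}"
    by (auto simp: evolve_def)
  also have "measure ?M \<dots> = ergodic_flow P \<pi> A {y} / \<pi> y"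
    using assms(2,3) le nn
    by (intro measure_uniform_unit_le)
       (auto simp: stationary_distribution_def ergodic_flow_def intro: sum_nonneg)
  finally show ?thesis .
qed

text \<open>The intertwining relation behind the duality: moving the set and then sampling from
  \<pi> on it has the same law as sampling first and then moving the point by \<open>P\<close>. The
  Doob factor \<pi>(S') cancels the normalisation of \<pi> on S', which leaves the probability that
  the new set contains \<open>y\<close>.\<close>

lemma doob_kernel_restrict_dist:
  assumes "stochastic P" "stationary_distribution P \<pi>" and pos: "\<And>y. 0 < \<pi> y"
  shows "(\<Sum>S' | S' \<noteq> {}. doob_kernel P \<pi> S S' * restrict_dist \<pi> S' y)
    = (\<Sum>z\<in>UNIV. restrict_dist \<pi> S z * P z y)"
proof -
  have "(\<Sum>S' | S' \<noteq> {}. doob_kernel P \<pi> S S' * restrict_dist \<pi> S' y)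
      = (\<Sum>S' | S' \<noteq> {}. (\<pi> y / sum \<pi> S) * (indicator S' y * evolving_kernel P \<pi> S S'))"
  proof (rule sum.cong[OF refl])
    fix S' :: "'a set" assume "S' \<in> {S'. S' \<noteq> {}}"
    then have "0 < sum \<pi> S'" using pos by (intro sum_pos) auto
    then show "doob_kernel P \<pi> S S' * restrict_dist \<pi> S' y
        = (\<pi> y / sum \<pi> S) * (indicator S' y * evolving_kernel P \<pi> S S')"
      by (simp add: doob_kernel_def restrict_dist_def)
  qed
  \<comment> \<open>The indicator keeps only the sets containing \<open>y\<close>, which are
    nonempty anyway.\<close>
  also have "\<dots> = (\<pi> y / sum \<pi> S) * (\<Sum>S' | y \<in> S'. evolving_kernel P \<pi> S S')"
    unfolding sum_distrib_left by (rule sum.mono_neutral_cong_right) auto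
  also have "\<dots> = ergodic_flow P \<pi> S {y} / sum \<pi> S"
    using sum_evolving_kernel_containing[OF assms(1,2) pos] pos[of y] by simp
  also have "\<dots> = (\<Sum>z\<in>S. \<pi> z * P z y / sum \<pi> S)"
    by (simp add: ergodic_flow_def sum_divide_distrib)
  also have "\<dots> = (\<Sum>z\<in>UNIV. restrict_dist \<pi> S z * P z y)"
    by (rule sum.mono_neutral_cong_left) (auto simp: restrict_dist_def)
  finally show ?thesis .
qed

text \<open>Iterates the intertwining relation, starting from the fact that \<pi> restricted to
  \<open>{x}\<close> and normalised is the point mass at \<open>x\<close>.\<close>

lemma kernel_pow_eq_doob_mixture:
  assumes "stochastic P" "stationary_distribution P \<pi>" and pos: "\<And>y. 0 < \<pi> y"
  shows "kernel_pow UNIV P n x y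
    = (\<Sum>S | S \<noteq> {}. doob_law P \<pi> {x} n S * restrict_dist \<pi> S y)"
proof (induction n arbitrary: y)
  case 0
  have "(\<Sum>S | S \<noteq> {}. doob_law P \<pi> {x} 0 S * restrict_dist \<pi> S y)
      = (\<Sum>S | S \<noteq> {}. if {x} = S then restrict_dist \<pi> S y else 0)"
    by (intro sum.cong) (auto simp: doob_law_def)
  also have "\<dots> = restrict_dist \<pi> {x} y" by simp
  also have "\<dots> = (if x = y then 1 else 0)" using pos[of x] by (auto simp: restrict_dist_def)
  finally show ?case by simp
next
  case (Suc n)
  have "(\<Sum>S' | S' \<noteq> {}. doob_law P \<pi> {x} (Suc n) S' * restrict_dist \<pi> S' y)
      = (\<Sum>S' | S' \<noteq> {}. \<Sum>S | S \<noteq> {}.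
          doob_law P \<pi> {x} n S * (doob_kernel P \<pi> S S' * restrict_dist \<pi> S' y))"
    by (simp add: doob_law_def sum_distrib_right mult.assoc)
  also have "\<dots> = (\<Sum>S | S \<noteq> {}. \<Sum>S' | S' \<noteq> {}.
          doob_law P \<pi> {x} n S * (doob_kernel P \<pi> S S' * restrict_dist \<pi> S' y))"
    by (rule sum.swap)
  also have "\<dots> = (\<Sum>S | S \<noteq> {}. \<Sum>z\<in>UNIV. doob_law P \<pi> {x} n S * (restrict_dist \<pi> S z * P z y))"
    by (simp add: doob_kernel_restrict_dist[OF assms] flip: sum_distrib_left)
  also have "\<dots> = (\<Sum>z\<in>UNIV. \<Sum>S | S \<noteq> {}. doob_law P \<pi> {x} n S * (restrict_dist \<pi> S z * P z y))"
    by (rule sum.swap)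
  also have "\<dots> = (\<Sum>z\<in>UNIV. kernel_pow UNIV P n x z * P z y)"
    by (simp add: Suc sum_distrib_right mult.assoc)
  finally show ?case by simp
qed

lemma doob_law_nonneg:
  assumes "\<And>y. 0 < \<pi> y"
  shows "0 \<le> doob_law P \<pi> S0 n S"
  unfolding doob_law_def doob_kernel_def evolving_kernel_def
  by (rule kernel_pow_nonneg)
     (intro mult_nonneg_nonneg divide_nonneg_nonneg sum_nonneg measure_nonneg less_imp_le assms)

lemma sum_restrict_dist:
  assumes "sum \<pi> S \<noteq> 0"
  shows "(\<Sum>y\<in>UNIV. restrict_dist \<pi> S y) = 1"
proof -
  have "(\<Sum>y\<in>UNIV. restrict_dist \<pi> S y) = (\<Sum>y\<in>S. \<pi> y / sum \<pi> S)"
    by (rule sum.mono_neutral_cong_right) (auto simp: restrict_dist_def)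
  then show ?thesis using assms by (simp flip: sum_divide_distrib)
qed

text \<open>Summing the mixture identity over \<open>y\<close> suffices: the n-step law and every
  normalised restriction have total mass one. No separate proof that \<open>doob_kernel\<close> is
  stochastic is required.\<close>

lemma sum_doob_law:
  assumes "stochastic P" "stationary_distribution P \<pi>" and pos: "\<And>y. 0 < \<pi> y"
  shows "(\<Sum>S | S \<noteq> {}. doob_law P \<pi> {x} n S) = 1"
proof -
  have ne: "sum \<pi> S \<noteq> 0" if "S \<noteq> {}" for S
    using that pos sum_pos[of S \<pi>] by (metis finite less_irrefl)
  have "1 = (\<Sum>y\<in>UNIV. \<Sum>S | S \<noteq> {}. doob_law P \<pi> {x} n S * restrict_dist \<pi> S y)"
    using sum_kernel_pow_stochastic[OF assms(1)] by (simp add: kernel_pow_eq_doob_mixture[OF assms])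
  also have "\<dots> = (\<Sum>S | S \<noteq> {}. \<Sum>y\<in>UNIV. doob_law P \<pi> {x} n S * restrict_dist \<pi> S y)"
    by (rule sum.swap)
  also have "\<dots> = (\<Sum>S | S \<noteq> {}. doob_law P \<pi> {x} n S)"
    by (simp add: sum_restrict_dist[OF ne] flip: sum_distrib_left)
  finally show ?thesis by simp
qed

section \<open>Convexity\<close>

text \<open>The graph lies above its tangent at the intermediate point \<open>z\<close>, and
  averaging the tangent inequality over \<open>a\<close> and \<open>b\<close> gives convexity. The
  endpoint 0 is included because restricted densities vanish off their set.\<close>

lemma convex_on_mult_ln: "convex_on {0..} (\<lambda>t::real. t * ln t)"
proof (rule convex_on_linorderI)
  fix t a b :: real assume t: "0 < t" "t < 1" and ab: "a \<in> {0..}" "b \<in> {0..}" "a < b"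
  define z where "z = (1 - t) * a + t * b"
  \<comment> \<open>Strict because \<open>b\<close> is positive, even when \<open>a\<close> is
    0.\<close>
  have z: "0 < z" using t ab by (auto simp: z_def intro: add_nonneg_pos)
  have tangent: "s * ln z + s - z \<le> s * ln s" if "0 \<le> s" for s
  proof (cases "s = 0")
    case False
    then have s: "0 < s" using that by simp
    have "s * ln (z / s) \<le> s * (z / s - 1)"
      using s z by (intro mult_left_mono ln_le_minus_one) auto
    then show ?thesis using s z by (simp add: ln_div algebra_simps)
  qed (use z in simp)
  have "(1 - t) * (a * ln z + a - z) + t * (b * ln z + b - z) \<le> (1 - t) * (a * ln a) + t * (b * ln b)"
    using t ab by (intro add_mono mult_left_mono tangent) auto
  moreover have "(1 - t) * (a * ln z + a - z) + t * (b * ln z + b - z) = z * ln z"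
    by (simp add: z_def algebra_simps)
  ultimately show "((1 - t) *\<^sub>R a + t *\<^sub>R b) * ln ((1 - t) *\<^sub>R a + t *\<^sub>R b)
      \<le> (1 - t) * (a * ln a) + t * (b * ln b)"
    by (simp add: z_def)
qed simp

text \<open>The square expands to \<open>t - 2 * sqrt t + 1\<close>, so the claim reduces to
  concavity of the square root.\<close>

lemma convex_on_sqrt_minus_one_squared: "convex_on {0..} (\<lambda>t. (sqrt t - 1)\<^sup>2)"
proof (rule convex_onI)
  fix t a b :: real assume t: "0 < t" "t < 1" and ab: "a \<in> {0..}" "b \<in> {0..}"
  define z where "z = (1 - t) * a + t * b"
  have z: "0 \<le> z" using t ab by (simp add: z_def)
  \<comment> \<open>This is the variance of a two-point distribution on \<open>sqrt a\<close> and
    \<open>sqrt b\<close>: the mean of the squares minus the square of the mean.\<close>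
  have "0 \<le> t * (1 - t) * (sqrt a - sqrt b)\<^sup>2" using t by simp
  also have "\<dots> = (1 - t) * (sqrt a)\<^sup>2 + t * (sqrt b)\<^sup>2 - ((1 - t) * sqrt a + t * sqrt b)\<^sup>2"
    by (simp add: power2_eq_square algebra_simps)
  finally have "((1 - t) * sqrt a + t * sqrt b)\<^sup>2 \<le> z" using ab by (simp add: z_def)
  then have "(1 - t) * sqrt a + t * sqrt b \<le> sqrt z" by (rule real_le_rsqrt)
  moreover have "(sqrt s - 1)\<^sup>2 = s - 2 * sqrt s + 1" if "0 \<le> s" for s :: real
    using that by (simp add: power2_diff)
  ultimately show "(sqrt ((1 - t) *\<^sub>R a + t *\<^sub>R b) - 1)\<^sup>2
      \<le> (1 - t) * (sqrt a - 1)\<^sup>2 + t * (sqrt b - 1)\<^sup>2"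
    using z ab by (simp add: z_def[symmetric]) (simp add: z_def algebra_simps)
qed simp

text \<open>Minkowski's inequality for finitely many weighted functions, by induction from the
  triangle inequality and homogeneity.\<close>

lemma L2_set_sum_le:
  assumes "finite A" "\<And>S. S \<in> A \<Longrightarrow> 0 \<le> w S"
  shows "L2_set (\<lambda>y. \<Sum>S\<in>A. w S * g S y) B \<le> (\<Sum>S\<in>A. w S * L2_set (g S) B)"
  using assms
proof (induction A rule: finite_induct)
  case (insert S A)
  have "L2_set (\<lambda>y. \<Sum>S\<in>insert S A. w S * g S y) B
      \<le> L2_set (\<lambda>y. w S * g S y) B + L2_set (\<lambda>y. \<Sum>S\<in>A. w S * g S y) B"
    using L2_set_triangle_ineq insert.hyps by simp
  then show ?case using insert by (simp add: L2_set_right_distrib)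
qed (simp add: L2_set_def)

section \<open>Distances between a mixture of restrictions and the base distribution\<close>

text \<open>Isolates what the distance bounds use of the chain: \<open>w\<close> will be the law of
  the n-th set and \<mu> the n-step distribution.\<close>

locale restriction_mixture =
  fixes \<pi> :: "'v::finite \<Rightarrow> real" and w :: "'v set \<Rightarrow> real" and \<mu> :: "'v \<Rightarrow> real"
  assumes pi_pos: "0 < \<pi> y"
    and sum_pi: "sum \<pi> UNIV = 1"
    and w_nonneg: "0 \<le> w S"
    and sum_w: "(\<Sum>S | S \<noteq> {}. w S) = 1"
    and mixture: "\<mu> y = (\<Sum>S | S \<noteq> {}. w S * restrict_dist \<pi> S y)"
begin

lemma sum_pi_pos: "S \<noteq> {} \<Longrightarrow> 0 < sum \<pi> S"
  by (rule sum_pos) (auto simp: pi_pos)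

lemma sum_pi_le_1: "sum \<pi> S \<le> 1"
  using sum_mono2[of UNIV S \<pi>] pi_pos sum_pi by (auto intro: less_imp_le)

lemma density_restrict_dist: "restrict_dist \<pi> S y / \<pi> y = indicator S y / sum \<pi> S"
  using pi_pos[of y] by (simp add: restrict_dist_def)

lemma density_mixture: "\<mu> y / \<pi> y = (\<Sum>S | S \<noteq> {}. w S * (restrict_dist \<pi> S y / \<pi> y))"
  by (simp add: mixture sum_divide_distrib)

lemma mixture_nonneg: "0 \<le> \<mu> y"
  unfolding mixture restrict_dist_def
  by (intro sum_nonneg mult_nonneg_nonneg divide_nonneg_nonneg w_nonneg)
     (auto simp: pi_pos less_imp_le)

text \<open>The density of a normalised restriction takes only two values, 1/\<pi>(S) on S and 0 off
  it.\<close>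

lemma sum_density_restrict_dist:
  assumes "S \<noteq> {}"
  shows "(\<Sum>y\<in>UNIV. \<pi> y * \<phi> (restrict_dist \<pi> S y / \<pi> y))
    = sum \<pi> S * \<phi> (1 / sum \<pi> S) + (1 - sum \<pi> S) * \<phi> 0"
proof -
  have "(\<Sum>y\<in>UNIV. \<pi> y * \<phi> (restrict_dist \<pi> S y / \<pi> y))
      = (\<Sum>y\<in>S. \<pi> y * \<phi> (restrict_dist \<pi> S y / \<pi> y))
        + (\<Sum>y\<in>-S. \<pi> y * \<phi> (restrict_dist \<pi> S y / \<pi> y))"
    by (subst sum.union_disjoint[symmetric]) (auto simp: Compl_partition)
  also have "\<dots> = (\<Sum>y\<in>S. \<pi> y * \<phi> (1 / sum \<pi> S)) + (\<Sum>y\<in>-S. \<pi> y * \<phi> 0)"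
    by (auto intro!: arg_cong2[where f = "(+)"] sum.cong simp: density_restrict_dist)
  also have "\<dots> = sum \<pi> S * \<phi> (1 / sum \<pi> S) + sum \<pi> (-S) * \<phi> 0"
    by (simp flip: sum_distrib_right)
  also have "sum \<pi> (-S) = 1 - sum \<pi> S"
    using sum_pi sum.subset_diff[of S UNIV \<pi>] by (simp add: Compl_eq_Diff_UNIV)
  finally show ?thesis .
qed

text \<open>Jensen's inequality at each state \<open>y\<close>, averaged with weights
  \<open>\<pi> y\<close>; after exchanging the sums, each set contributes its two-valued
  density.\<close>

lemma f_divergence_le:
  assumes "convex_on {0..} \<phi>"
  shows "(\<Sum>y\<in>UNIV. \<pi> y * \<phi> (\<mu> y / \<pi> y))
    \<le> (\<Sum>S | S \<noteq> {}. w S * (sum \<pi> S * \<phi> (1 / sum \<pi> S) + (1 - sum \<pi> S) * \<phi> 0))"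
proof -
  have "\<phi> (\<mu> y / \<pi> y) \<le> (\<Sum>S | S \<noteq> {}. w S * \<phi> (restrict_dist \<pi> S y / \<pi> y))" for y
  proof -
    have "\<phi> (\<Sum>S | S \<noteq> {}. w S *\<^sub>R (restrict_dist \<pi> S y / \<pi> y))
        \<le> (\<Sum>S | S \<noteq> {}. w S * \<phi> (restrict_dist \<pi> S y / \<pi> y))"
      by (rule convex_on_sum[OF _ _ assms sum_w w_nonneg])
         (auto simp: density_restrict_dist sum_pi_pos less_imp_le)
    then show ?thesis by (simp add: density_mixture)
  qed
  then have "(\<Sum>y\<in>UNIV. \<pi> y * \<phi> (\<mu> y / \<pi> y))
      \<le> (\<Sum>y\<in>UNIV. \<pi> y * (\<Sum>S | S \<noteq> {}. w S * \<phi> (restrict_dist \<pi> S y / \<pi> y)))"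
    by (intro sum_mono mult_left_mono) (auto simp: pi_pos less_imp_le)
  also have "\<dots> = (\<Sum>y\<in>UNIV. \<Sum>S | S \<noteq> {}. w S * (\<pi> y * \<phi> (restrict_dist \<pi> S y / \<pi> y)))"
    by (simp add: sum_distrib_left mult.left_commute)
  also have "\<dots> = (\<Sum>S | S \<noteq> {}. \<Sum>y\<in>UNIV. w S * (\<pi> y * \<phi> (restrict_dist \<pi> S y / \<pi> y)))"
    by (rule sum.swap)
  also have "\<dots> = (\<Sum>S | S \<noteq> {}. w S * (sum \<pi> S * \<phi> (1 / sum \<pi> S) + (1 - sum \<pi> S) * \<phi> 0))"
    by (intro sum.cong) (auto simp: sum_density_restrict_dist simp flip: sum_distrib_left)
  finally show ?thesis .
qed

section \<open>Separation and pointwise deviation\<close>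

lemma density_minus_one:
  "\<mu> y / \<pi> y - 1 = (\<Sum>S | S \<noteq> {}. w S * (restrict_dist \<pi> S y / \<pi> y - 1))"
  by (simp add: density_mixture right_diff_distrib sum_subtractf sum_w)

lemma restrict_dist_UNIV: "restrict_dist \<pi> UNIV y / \<pi> y = 1"
  by (simp add: density_restrict_dist sum_pi)

text \<open>The whole space contributes at most zero, so the constant \<open>c\<close> is paid only
  when the set is proper. This is how the probability of not having reached \<open>UNIV\<close>
  enters.\<close>

lemma sum_mult_le_proper:
  assumes "f UNIV \<le> 0" "\<And>S. S \<noteq> {} \<Longrightarrow> f S \<le> c"
  shows "(\<Sum>S | S \<noteq> {}. w S * f S) \<le> c * (\<Sum>S | S \<noteq> {} \<and> S \<noteq> UNIV. w S)"
proof -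
  have "(\<Sum>S | S \<noteq> {}. w S * f S) \<le> (\<Sum>S | S \<noteq> {}. if S \<noteq> UNIV then w S * c else 0)"
    using assms w_nonneg by (intro sum_mono) (auto intro: mult_left_mono mult_nonneg_nonpos)
  also have "\<dots> = (\<Sum>S | S \<noteq> {} \<and> S \<noteq> UNIV. w S * c)"
    by (rule sum.mono_neutral_cong_right) auto
  finally show ?thesis by (simp add: sum_distrib_left mult.commute)
qed

lemma separation_le: "separation \<mu> \<pi> \<le> (\<Sum>S | S \<noteq> {} \<and> S \<noteq> UNIV. w S)"
proof -
  have "1 - \<mu> y / \<pi> y \<le> (\<Sum>S | S \<noteq> {} \<and> S \<noteq> UNIV. w S)" for y
  proof -
    have "1 - \<mu> y / \<pi> y = (\<Sum>S | S \<noteq> {}. w S * (1 - restrict_dist \<pi> S y / \<pi> y))"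
      using density_minus_one[of y] by (simp add: right_diff_distrib sum_subtractf)
    also have "\<dots> \<le> 1 * (\<Sum>S | S \<noteq> {} \<and> S \<noteq> UNIV. w S)"
      by (rule sum_mult_le_proper)
         (auto simp: restrict_dist_UNIV density_restrict_dist[of S for S] sum_pi sum_pi_pos less_imp_le)
    finally show ?thesis by simp
  qed
  then show ?thesis by (simp add: separation_def)
qed

text \<open>The restricted density at \<open>y\<close> deviates from one by 1 if \<open>y\<close> is
  outside S and by 1/\<pi>(S) - 1 otherwise; in the second case \<pi>(S) is at least
  \<open>\<pi> y\<close>.\<close>

lemma density_deviation_le:
  "\<bar>\<mu> y / \<pi> y - 1\<bar> \<le> max ((1 - \<pi> y) / \<pi> y) 1 * (\<Sum>S | S \<noteq> {} \<and> S \<noteq> UNIV. w S)"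
proof -
  have "\<bar>\<mu> y / \<pi> y - 1\<bar> \<le> (\<Sum>S | S \<noteq> {}. w S * \<bar>restrict_dist \<pi> S y / \<pi> y - 1\<bar>)"
    unfolding density_minus_one
    by (rule order_trans[OF sum_abs]) (simp add: abs_mult w_nonneg)
  also have "\<dots> \<le> max ((1 - \<pi> y) / \<pi> y) 1 * (\<Sum>S | S \<noteq> {} \<and> S \<noteq> UNIV. w S)"
  proof (rule sum_mult_le_proper)
    fix S :: "'v set" assume "S \<noteq> {}"
    show "\<bar>restrict_dist \<pi> S y / \<pi> y - 1\<bar> \<le> max ((1 - \<pi> y) / \<pi> y) 1"
    proof (cases "y \<in> S")
      case True
      then have le: "\<pi> y \<le> sum \<pi> S"
        using pi_pos by (intro member_le_sum) (auto simp: less_imp_le)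
      then have "1 / sum \<pi> S \<le> 1 / \<pi> y" using pi_pos[of y] by (simp add: frac_le)
      moreover have "1 \<le> 1 / sum \<pi> S" using sum_pi_le_1 sum_pi_pos[OF \<open>S \<noteq> {}\<close>] by simp
      moreover have "(1 - \<pi> y) / \<pi> y = 1 / \<pi> y - 1"
        using pi_pos[of y] by (simp add: diff_divide_distrib)
      ultimately show ?thesis using True by (simp add: density_restrict_dist)
    qed (simp add: density_restrict_dist)
  qed (simp add: restrict_dist_UNIV)
  finally show ?thesis .
qed

section \<open>Total variation, relative entropy and Hellinger distance from convex functions of the
  density\<close>

lemma tv_dist_le: "tv_dist \<mu> \<pi> \<le> (\<Sum>S | S \<noteq> {}. w S * (1 - sum \<pi> S))"
proof -
  \<comment> \<open>The convex function is the distance to 1, written with \<open>dist\<close> to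
    match \<open>convex_on_dist\<close>.\<close>
  have "tv_dist \<mu> \<pi> = 1 / 2 * (\<Sum>y\<in>UNIV. \<pi> y * dist 1 (\<mu> y / \<pi> y))"
    unfolding tv_dist_def
  proof (intro arg_cong[where f = "(*) (1 / 2)"] sum.cong refl)
    fix y
    have "\<pi> y * (1 - \<mu> y / \<pi> y) = \<pi> y - \<mu> y"
      using pi_pos[of y] by (simp add: right_diff_distrib)
    then have "\<bar>\<mu> y - \<pi> y\<bar> = \<bar>\<pi> y * (1 - \<mu> y / \<pi> y)\<bar>"
      by (simp add: abs_minus_commute)
    then show "\<bar>\<mu> y - \<pi> y\<bar> = \<pi> y * dist 1 (\<mu> y / \<pi> y)"
      using pi_pos[of y] by (simp add: abs_mult dist_real_def)
  qed
  also have "\<dots> \<le> 1 / 2 * (\<Sum>S | S \<noteq> {}.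
      w S * (sum \<pi> S * dist 1 (1 / sum \<pi> S) + (1 - sum \<pi> S) * dist (1::real) 0))"
    by (intro mult_left_mono f_divergence_le convex_on_dist) auto
  \<comment> \<open>The excess on S and the deficit off S both equal 1 - \<pi>(S), which cancels the
    factor 1/2.\<close>
  also have "\<dots> = 1 / 2 * (\<Sum>S | S \<noteq> {}. w S * (2 * (1 - sum \<pi> S)))"
  proof (intro arg_cong[where f = "(*) (1 / 2)"] sum.cong refl)
    fix S :: "'v set" assume "S \<in> {S. S \<noteq> {}}"
    then have p: "0 < sum \<pi> S" by (simp add: sum_pi_pos)
    then have "1 \<le> 1 / sum \<pi> S" using sum_pi_le_1 by simp
    then have "sum \<pi> S * dist 1 (1 / sum \<pi> S) = 1 - sum \<pi> S"
      using p by (simp add: dist_real_def right_diff_distrib)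
    then show "w S * (sum \<pi> S * dist 1 (1 / sum \<pi> S) + (1 - sum \<pi> S) * dist (1::real) 0)
        = w S * (2 * (1 - sum \<pi> S))"
      by simp
  qed
  also have "\<dots> = (\<Sum>S | S \<noteq> {}. w S * (1 - sum \<pi> S))"
    unfolding sum_distrib_left by (intro sum.cong) auto
  finally show ?thesis .
qed

lemma rel_entropy_le: "rel_entropy \<mu> \<pi> \<le> (\<Sum>S | S \<noteq> {}. w S * ln (1 / sum \<pi> S))"
proof -
  have "rel_entropy \<mu> \<pi> = (\<Sum>y\<in>UNIV. \<pi> y * (\<mu> y / \<pi> y * ln (\<mu> y / \<pi> y)))"
    unfolding rel_entropy_def using pi_pos by (intro sum.cong) (auto simp: less_imp_neq[symmetric])
  also have "\<dots> \<le> (\<Sum>S | S \<noteq> {}.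
      w S * (sum \<pi> S * (1 / sum \<pi> S * ln (1 / sum \<pi> S)) + (1 - sum \<pi> S) * (0 * ln 0)))"
    by (rule f_divergence_le[OF convex_on_mult_ln])
  also have "\<dots> = (\<Sum>S | S \<noteq> {}. w S * ln (1 / sum \<pi> S))"
  proof (intro sum.cong refl)
    fix S :: "'v set" assume "S \<in> {S. S \<noteq> {}}"
    then have "0 < sum \<pi> S" by (simp add: sum_pi_pos)
    then show "w S * (sum \<pi> S * (1 / sum \<pi> S * ln (1 / sum \<pi> S)) + (1 - sum \<pi> S) * (0 * ln 0))
        = w S * ln (1 / sum \<pi> S)"
      by simp
  qed
  finally show ?thesis .
qed

lemma hellinger_le: "hellinger \<mu> \<pi> \<le> 2 * (\<Sum>S | S \<noteq> {}. w S * (1 - sqrt (sum \<pi> S)))"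
proof -
  have "hellinger \<mu> \<pi> = (\<Sum>y\<in>UNIV. \<pi> y * (sqrt (\<mu> y / \<pi> y) - 1)\<^sup>2)"
    unfolding hellinger_def by (simp add: mult.commute)
  also have "\<dots> \<le> (\<Sum>S | S \<noteq> {}.
      w S * (sum \<pi> S * (sqrt (1 / sum \<pi> S) - 1)\<^sup>2 + (1 - sum \<pi> S) * (sqrt 0 - 1)\<^sup>2))"
    by (rule f_divergence_le[OF convex_on_sqrt_minus_one_squared])
  also have "\<dots> = (\<Sum>S | S \<noteq> {}. 2 * (w S * (1 - sqrt (sum \<pi> S))))"
  proof (intro sum.cong refl)
    fix S :: "'v set" assume "S \<in> {S. S \<noteq> {}}"
    then have p: "0 < sum \<pi> S" by (simp add: sum_pi_pos)
    \<comment> \<open>The prefactor moves inside the square as its own root, so the part on S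
      becomes the square of 1 - \<open>sqrt (sum \<pi> S)\<close>.\<close>
    then have "sum \<pi> S * (sqrt (1 / sum \<pi> S) - 1)\<^sup>2 = (sqrt (sum \<pi> S) * (1 / sqrt (sum \<pi> S) - 1))\<^sup>2"
      by (simp add: power_mult_distrib real_sqrt_divide)
    also have "\<dots> = (1 - sqrt (sum \<pi> S))\<^sup>2"
      using p by (simp add: right_diff_distrib)
    also have "\<dots> = 1 - 2 * sqrt (sum \<pi> S) + sum \<pi> S"
      using p by (simp add: power2_diff)
    finally have "sum \<pi> S * (sqrt (1 / sum \<pi> S) - 1)\<^sup>2 + (1 - sum \<pi> S) * (sqrt 0 - 1)\<^sup>2
        = 2 * (1 - sqrt (sum \<pi> S))"
      by simp
    then show "w S * (sum \<pi> S * (sqrt (1 / sum \<pi> S) - 1)\<^sup>2 + (1 - sum \<pi> S) * (sqrt 0 - 1)\<^sup>2)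
        = 2 * (w S * (1 - sqrt (sum \<pi> S)))"
      by simp
  qed
  finally show ?thesis by (simp flip: sum_distrib_left)
qed

section \<open>The weighted L2 distance as a Euclidean norm\<close>

lemma l2_dist_eq_L2_set: "l2_dist \<nu> \<pi> = L2_set (\<lambda>y. sqrt (\<pi> y) * (\<nu> y / \<pi> y - 1)) UNIV"
  using pi_pos by (simp add: l2_dist_def L2_set_def power_mult_distrib less_imp_le)

lemma l2_dist_restrict_dist:
  assumes "S \<noteq> {}"
  shows "l2_dist (restrict_dist \<pi> S) \<pi> = sqrt ((1 - sum \<pi> S) / sum \<pi> S)"
proof -
  have "(\<Sum>y\<in>UNIV. \<pi> y * \<bar>restrict_dist \<pi> S y / \<pi> y - 1\<bar>\<^sup>2)
      = sum \<pi> S * \<bar>1 / sum \<pi> S - 1\<bar>\<^sup>2 + (1 - sum \<pi> S) * \<bar>0 - 1\<bar>\<^sup>2"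
    by (rule sum_density_restrict_dist[OF assms])
  also have "\<dots> = (1 - sum \<pi> S) / sum \<pi> S"
    using sum_pi_pos[OF assms] by (simp add: power2_eq_square field_simps)
  finally show ?thesis by (simp add: l2_dist_def)
qed

text \<open>Minkowski averages the norm itself. Applying \<open>f_divergence_le\<close> to the
  squared deviation would bound only the squared norm, and the root of an average is at least the
  average of the roots.\<close>

lemma l2_dist_le: "l2_dist \<mu> \<pi> \<le> (\<Sum>S | S \<noteq> {}. w S * sqrt ((1 - sum \<pi> S) / sum \<pi> S))"
proof -
  have "l2_dist \<mu> \<pi> = L2_set (\<lambda>y. \<Sum>S | S \<noteq> {}.
      w S * (sqrt (\<pi> y) * (restrict_dist \<pi> S y / \<pi> y - 1))) UNIV"
    unfolding l2_dist_eq_L2_set density_minus_one by (simp add: sum_distrib_left mult.left_commute)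
  also have "\<dots> \<le> (\<Sum>S | S \<noteq> {}. w S * l2_dist (restrict_dist \<pi> S) \<pi>)"
    unfolding l2_dist_eq_L2_set by (rule L2_set_sum_le) (auto simp: w_nonneg)
  also have "\<dots> = (\<Sum>S | S \<noteq> {}. w S * sqrt ((1 - sum \<pi> S) / sum \<pi> S))"
    by (intro sum.cong) (auto simp: l2_dist_restrict_dist)
  finally show ?thesis .
qed

end

section \<open>Wasserstein distance\<close>

text \<open>The dual value of the optimal transport problem with cost \<open>c\<close>: for a power
  of \<open>d\<close> it is what \<open>wasserstein\<close> takes the root of.\<close>

definition kantorovich :: "('v::finite \<Rightarrow> 'v \<Rightarrow> real) \<Rightarrow> ('v \<Rightarrow> real) \<Rightarrow> ('v \<Rightarrow> real) \<Rightarrow> real" where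
  "kantorovich c \<mu> \<nu> = (SUP (f, g) \<in> {(f, g). \<forall>y z. f y + g z \<le> c y z}.
     (\<Sum>y\<in>UNIV. \<mu> y * f y) + (\<Sum>z\<in>UNIV. \<nu> z * g z))"

text \<open>A real supremum dominates its members only if they are bounded above. Here the bound is
  the cost of the product coupling: average the constraint over \<mu> and \<nu>
  independently.\<close>

lemma kantorovich_upper:
  assumes "prob_vec \<mu>" "prob_vec \<nu>" and fg: "\<And>y z. f y + g z \<le> c y z"
  shows "(\<Sum>y\<in>UNIV. \<mu> y * f y) + (\<Sum>z\<in>UNIV. \<nu> z * g z) \<le> kantorovich c \<mu> \<nu>"
proof -
  have bound: "(\<Sum>y\<in>UNIV. \<mu> y * f y) + (\<Sum>z\<in>UNIV. \<nu> z * g z)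
      \<le> (\<Sum>y\<in>UNIV. \<Sum>z\<in>UNIV. \<mu> y * \<nu> z * c y z)"
    if "\<And>y z. f y + g z \<le> c y z" for f g
  proof -
    have one: "sum \<mu> UNIV = 1" "sum \<nu> UNIV = 1" using assms by (auto simp: prob_vec_def)
    have "(\<Sum>y\<in>UNIV. \<Sum>z\<in>UNIV. \<mu> y * \<nu> z * (f y + g z))
        = (\<Sum>y\<in>UNIV. \<Sum>z\<in>UNIV. (\<mu> y * f y) * \<nu> z) + (\<Sum>y\<in>UNIV. \<Sum>z\<in>UNIV. \<mu> y * (\<nu> z * g z))"
      by (simp add: algebra_simps sum.distrib)
    also have "\<dots> = (\<Sum>y\<in>UNIV. \<mu> y * f y) + (\<Sum>z\<in>UNIV. \<nu> z * g z)"
      using one by (simp flip: sum_distrib_left sum_distrib_right)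
    finally have "(\<Sum>y\<in>UNIV. \<mu> y * f y) + (\<Sum>z\<in>UNIV. \<nu> z * g z)
        = (\<Sum>y\<in>UNIV. \<Sum>z\<in>UNIV. \<mu> y * \<nu> z * (f y + g z))" ..
    also have "\<dots> \<le> (\<Sum>y\<in>UNIV. \<Sum>z\<in>UNIV. \<mu> y * \<nu> z * c y z)"
      using assms that by (intro sum_mono mult_left_mono) (auto simp: prob_vec_def)
    finally show ?thesis .
  qed
  have "bdd_above ((\<lambda>(f, g). (\<Sum>y\<in>UNIV. \<mu> y * f y) + (\<Sum>z\<in>UNIV. \<nu> z * g z))
      ` {(f, g). \<forall>y z. f y + g z \<le> c y z})"
    by (rule bdd_aboveI2[where M = "\<Sum>y\<in>UNIV. \<Sum>z\<in>UNIV. \<mu> y * \<nu> z * c y z"]) (auto intro: bound)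
  from cSUP_upper[OF _ this, of "(f, g)"] fg show ?thesis
    by (auto simp: kantorovich_def)
qed

lemma kantorovich_nonneg:
  assumes "prob_vec \<mu>" "prob_vec \<nu>" "\<And>y z. 0 \<le> c y z"
  shows "0 \<le> kantorovich c \<mu> \<nu>"
  using kantorovich_upper[OF assms(1,2), of "\<lambda>_. 0" "\<lambda>_. 0" c] assms(3) by simp

lemma wasserstein_eq_kantorovich:
  "wasserstein d p \<mu> \<nu> = kantorovich (\<lambda>y z. d y z powr p) \<mu> \<nu> powr (1 / p)"
  by (simp add: wasserstein_def kantorovich_def)

section \<open>Transport cost of a mixture\<close>

context restriction_mixture
begin

lemma prob_vec_pi: "prob_vec \<pi>"
  using pi_pos sum_pi by (auto simp: prob_vec_def less_imp_le)

lemma prob_vec_restrict_dist: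
  assumes "S \<noteq> {}"
  shows "prob_vec (restrict_dist \<pi> S)"
  unfolding prob_vec_def
proof
  show "\<forall>y. 0 \<le> restrict_dist \<pi> S y"
    using pi_pos sum_pi_pos[OF assms] by (auto simp: restrict_dist_def less_imp_le)
  show "(\<Sum>y\<in>UNIV. restrict_dist \<pi> S y) = 1"
    using sum_pi_pos[OF assms] by (intro sum_restrict_dist) simp
qed

text \<open>For a fixed admissible pair the objective is affine in \<mu>, so it is the average of
  its values at the restrictions, each at most the corresponding supremum.\<close>

lemma kantorovich_le:
  assumes "\<And>y z. 0 \<le> c y z"
  shows "kantorovich c \<mu> \<pi> \<le> (\<Sum>S | S \<noteq> {}. w S * kantorovich c (restrict_dist \<pi> S) \<pi>)"
  unfolding kantorovich_def[of c \<mu> \<pi>]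
proof (rule cSUP_least)
  show "{(f, g). \<forall>y z. f y + g z \<le> c y z} \<noteq> {}"
    using assms by (auto intro!: exI[of _ "\<lambda>_. 0"])
next
  fix fg assume "fg \<in> {(f, g). \<forall>y z. f y + g z \<le> c y z}"
  then obtain f g where fg: "fg = (f, g)" "\<And>y z. f y + g z \<le> c y z" by auto
  have "(\<Sum>y\<in>UNIV. \<mu> y * f y) = (\<Sum>y\<in>UNIV. \<Sum>S | S \<noteq> {}. w S * (restrict_dist \<pi> S y * f y))"
    by (simp add: mixture sum_distrib_right mult.assoc)
  also have "\<dots> = (\<Sum>S | S \<noteq> {}. \<Sum>y\<in>UNIV. w S * (restrict_dist \<pi> S y * f y))"
    by (rule sum.swap)
  also have "\<dots> = (\<Sum>S | S \<noteq> {}. w S * (\<Sum>y\<in>UNIV. restrict_dist \<pi> S y * f y))"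
    by (simp add: sum_distrib_left)
  \<comment> \<open>The weights sum to one, so the term in \<open>g\<close> can be distributed over
    all sets.\<close>
  also have "\<dots> + (\<Sum>z\<in>UNIV. \<pi> z * g z)
      = (\<Sum>S | S \<noteq> {}. w S * ((\<Sum>y\<in>UNIV. restrict_dist \<pi> S y * f y) + (\<Sum>z\<in>UNIV. \<pi> z * g z)))"
    by (simp add: distrib_left sum.distrib sum_w flip: sum_distrib_right)
  also have "\<dots> \<le> (\<Sum>S | S \<noteq> {}. w S * kantorovich c (restrict_dist \<pi> S) \<pi>)"
    by (intro sum_mono mult_left_mono w_nonneg kantorovich_upper prob_vec_pi fg(2)
        prob_vec_restrict_dist) simp
  finally show "(case fg of (f, g) \<Rightarrow> (\<Sum>y\<in>UNIV. \<mu> y * f y) + (\<Sum>z\<in>UNIV. \<pi> z * g z))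
      \<le> (\<Sum>S | S \<noteq> {}. w S * kantorovich c (restrict_dist \<pi> S) \<pi>)"
    by (simp add: fg(1))
qed

lemma prob_vec_mixture: "prob_vec \<mu>"
proof -
  have "(\<Sum>y\<in>UNIV. \<mu> y) = (\<Sum>S | S \<noteq> {}. \<Sum>y\<in>UNIV. w S * restrict_dist \<pi> S y)"
    unfolding mixture by (rule sum.swap)
  also have "\<dots> = (\<Sum>S | S \<noteq> {}. w S)"
    using prob_vec_restrict_dist
    by (intro sum.cong) (auto simp: prob_vec_def simp flip: sum_distrib_left)
  finally show ?thesis by (simp add: prob_vec_def mixture_nonneg sum_w)
qed

lemma wasserstein_le:
  assumes "1 \<le> p"
  shows "wasserstein d p \<mu> \<pi>
    \<le> (\<Sum>S | S \<noteq> {}. w S * wasserstein d p (restrict_dist \<pi> S) \<pi> powr p) powr (1 / p)"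
proof -
  let ?c = "\<lambda>y z. d y z powr p"
  \<comment> \<open>The power undoes the root because the transport cost is nonnegative;
    monotonicity of the root then finishes.\<close>
  have "(\<Sum>S | S \<noteq> {}. w S * wasserstein d p (restrict_dist \<pi> S) \<pi> powr p)
      = (\<Sum>S | S \<noteq> {}. w S * kantorovich ?c (restrict_dist \<pi> S) \<pi>)"
    using assms
    by (intro sum.cong)
       (auto simp: wasserstein_eq_kantorovich powr_powr powr_one
         kantorovich_nonneg[OF prob_vec_restrict_dist prob_vec_pi])
  then show ?thesis
    using assms kantorovich_nonneg[OF prob_vec_mixture prob_vec_pi, of ?c] kantorovich_le[of ?c]
    by (auto simp: wasserstein_eq_kantorovich intro!: powr_mono2)
qed

end

theorem theorem2p2p2:
  fixes P :: "'v::finite \<Rightarrow> 'v \<Rightarrow> real" and \<pi> :: "'v \<Rightarrow> real" and x y :: 'v and n :: nat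
  assumes "stochastic P" and "irreducible_kernel P" and "aperiodic_kernel P"
    and "stationary_distribution P \<pi>"
  shows "separation (kernel_pow UNIV P n x) \<pi> \<le> doob_prob P \<pi> {x} n (\<lambda>S. S \<noteq> UNIV)
    \<and> tv_dist (kernel_pow UNIV P n x) \<pi> \<le> doob_expectation P \<pi> {x} n (\<lambda>S. 1 - sum \<pi> S)
    \<and> rel_entropy (kernel_pow UNIV P n x) \<pi> \<le> doob_expectation P \<pi> {x} n (\<lambda>S. ln (1 / sum \<pi> S))
    \<and> l2_dist (kernel_pow UNIV P n x) \<pi>
        \<le> doob_expectation P \<pi> {x} n (\<lambda>S. sqrt ((1 - sum \<pi> S) / sum \<pi> S))
    \<and> \<bar>kernel_pow UNIV P n x y / \<pi> y - 1\<bar>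
        \<le> max ((1 - \<pi> y) / \<pi> y) 1 * doob_prob P \<pi> {x} n (\<lambda>S. S \<noteq> UNIV)
    \<and> hellinger (kernel_pow UNIV P n x) \<pi>
        \<le> 2 * doob_expectation P \<pi> {x} n (\<lambda>S. 1 - sqrt (sum \<pi> S))
    \<and> (\<forall>d p. Metric_space UNIV d \<longrightarrow> p \<ge> 1 \<longrightarrow>
        wasserstein d p (kernel_pow UNIV P n x) \<pi>
          \<le> (doob_expectation P \<pi> {x} n
               (\<lambda>S. wasserstein d p (restrict_dist \<pi> S) \<pi> powr p)) powr (1 / p))"
proof -
  have pos: "0 < \<pi> z" for z
    by (rule stationary_distribution_pos[OF assms(1,2,4)])
  \<comment> \<open>The duality supplies the mixture identity, with the law of the n-th set as
    weights.\<close>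
  interpret restriction_mixture \<pi> "doob_law P \<pi> {x} n" "kernel_pow UNIV P n x"
  proof
    show "sum \<pi> UNIV = 1"
      using assms(4) by (simp add: stationary_distribution_def prob_vec_def)
  qed (simp_all add: pos doob_law_nonneg sum_doob_law[OF assms(1,4)]
      kernel_pow_eq_doob_mixture[OF assms(1,4)])
  show ?thesis
    unfolding doob_prob_def doob_expectation_def
    by (intro conjI allI impI separation_le tv_dist_le rel_entropy_le l2_dist_le
        density_deviation_le hellinger_le wasserstein_le)
qed

end
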